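(* Let $f\colon\mathcal X\setminus\mathcal O\to(0,\infty)$ and $g\colon\mathcal O\to\mathbb R$, and let $u,v\colon\mathcal X\to\mathbb R$ satisfy $$u(x)\le F[u](x)\ \text{ for } x\in\mathcal X\setminus\mathcal O,\qquad u(x)\le g(x)\ \text{ for } x\in\mathcal O,$$ and $$v(x)\ge F[v](x)\ \text{ for } x\in\mathcal X\setminus\mathcal O,\qquad v(x)\ge g(x)\ \text{ for } x\in\mathcal O.$$ Then $u\le v$ in $\mathcal X$.
   Context: $\mathcal G=(\mathcal X,E)$ is a finite simple undirected graph, $\mathcal O\subseteq\mathcal X$ is the set of boundary vertices, and $\mathcal N_x$ is the set of neighbors of $x$. There is a fixed even integer $n\ge2$ with $|\mathcal N_x|=n$ for every $x\in\mathcal X\setminus\mathcal O$ (no degree condition on vertices of $\mathcal O$). For $u\colon\mathcal X\to\mathbb R$, $x\in\mathcal X\setminus\mathcal O$ and $i\in\{1,\dots,n/2\}$, define $$H_i[u](x)=\min_{\substack{S\subseteq\mathcal N_x\\ |S|=2i}}\ \max_{\substack{y,z\in S\\ y\ne z}}\frac{u(y)+u(z)}2.$$ Let $\mathcal A_k=\{\alpha\in(0,\infty)^k:\prod_{i=1}^k\alpha_i=1\}$ and, given $f$, for $x\in\mathcal X\setminus\mathcal O$, $$F[u](x)=\inf_{\alpha\in\mathcal A_{n/2}}\frac{\sum_{i=1}^{n/2}\alpha_iH_i[u](x)-\frac n2f(x)^{2/n}}{\sum_{i=1}^{n/2}\alpha_i}.$$ *)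

theory Defs
  imports Complex_Main "HOL-Library.FuncSet"
begin

definition finite_simple_graph :: "'a set \<Rightarrow> 'a set set \<Rightarrow> bool" where
  "finite_simple_graph X E \<longleftrightarrow> finite X \<and> (\<forall>e\<in>E. e \<subseteq> X \<and> card e = 2)"

definition neighbours :: "'a set set \<Rightarrow> 'a \<Rightarrow> 'a set" where
  "neighbours E x = {y. {x, y} \<in> E}"

text \<open>In \<open>H\<close>, the sets under \<open>Min\<close> and \<open>Max\<close> are finite and nonempty whenever \<open>x\<close> has
  finitely many neighbours and \<open>2 \<le> 2 * i \<le> card (neighbours E x)\<close>.\<close>

definition H :: "'a set set \<Rightarrow> nat \<Rightarrow> ('a \<Rightarrow> real) \<Rightarrow> 'a \<Rightarrow> real" where
  "H E i u x =
     Min ((\<lambda>S. Max {(u y + u z) / 2 | y z. y \<in> S \<and> z \<in> S \<and> y \<noteq> z})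
          ` {S. S \<subseteq> neighbours E x \<and> card S = 2 * i})"

definition weights :: "nat \<Rightarrow> (nat \<Rightarrow> real) set" where
  "weights k = {\<alpha> \<in> {1..k} \<rightarrow>\<^sub>E {0<..}. (\<Prod>i=1..k. \<alpha> i) = 1}"

text \<open>The infimum in \<open>F\<close> is a genuine one when \<open>n \<ge> 2\<close>: the index set contains the all-one
  weights, and by the inequality of arithmetic and geometric means \<open>(\<Sum>i=1..n div 2. \<alpha> i) \<ge> n div 2\<close>,
  so the quotients are bounded below.\<close>

definition F :: "'a set set \<Rightarrow> nat \<Rightarrow> ('a \<Rightarrow> real) \<Rightarrow> ('a \<Rightarrow> real) \<Rightarrow> 'a \<Rightarrow> real" where
  "F E n f u x =
     (INF \<alpha>\<in>weights (n div 2).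
        ((\<Sum>i=1..n div 2. \<alpha> i * H E i u x) - real n / 2 * f x powr (2 / real n))
          / (\<Sum>i=1..n div 2. \<alpha> i))"

end

theory Submission
  imports Defs
begin

text \<open>Suppose \<open>M = max (u - v) > 0\<close>, and let \<open>x\<close> maximise \<open>u\<close> among the points where \<open>u - v = M\<close>;
  it is an interior point. There \<open>u x \<le> F[u](x)\<close> forces \<open>H\<^sub>i[u](x) > u x\<close> for all \<open>i\<close>, since a large
  weight can be put on a single index. With \<open>k = n / 2\<close>, \<open>H\<^sub>k[u](x)\<close> is the mean over the top pair of
  neighbours, so one of the two exceeds \<open>u x\<close> and thus lies outside the contact set.
  Hence \<open>H\<^sub>k[u](x) < H\<^sub>k[v](x) + M\<close>, while \<open>H\<^sub>i[u](x) \<le> H\<^sub>i[v](x) + M\<close> for the other \<open>i\<close>. As all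
  \<open>H\<^sub>i[u](x) - u x\<close> are positive, only weights in a bounded set matter; those are bounded away
  from zero, so the strict inequality at one index survives the infimum and contradicts
  \<open>u x - v x = M\<close>.\<close>

section \<open>Positive weights with product one\<close>

lemma weights_pos: "\<alpha> \<in> weights k \<Longrightarrow> i \<in> {1..k} \<Longrightarrow> \<alpha> i > 0"
  by (auto simp: weights_def PiE_def Pi_def)

lemma weights_nonneg: "\<alpha> \<in> weights k \<Longrightarrow> i \<in> {1..k} \<Longrightarrow> 0 \<le> \<alpha> i"
  using weights_pos by (rule less_imp_le)

lemma weights_prod: "\<alpha> \<in> weights k \<Longrightarrow> (\<Prod>i=1..k. \<alpha> i) = 1"
  by (simp add: weights_def)

lemma weights_le_sum:
  assumes "\<alpha> \<in> weights k" "i \<in> {1..k}"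
  shows "\<alpha> i \<le> (\<Sum>i=1..k. \<alpha> i)"
  using assms weights_nonneg[OF assms(1)] by (intro member_le_sum) auto

text \<open>If the sum were below one, so would be every weight, and hence the product. This keeps
  the denominators in \<open>F\<close> away from zero.\<close>

lemma weights_sum_ge_1:
  assumes "\<alpha> \<in> weights k" "k \<ge> 1"
  shows "(\<Sum>i=1..k. \<alpha> i) \<ge> 1"
proof (rule ccontr)
  assume less: "\<not> ?thesis"
  have "\<alpha> i < 1" if "i \<in> {1..k}" for i
    using weights_le_sum[OF assms(1) that] less by linarith
  then have "(\<Prod>i=1..k. \<alpha> i) < (\<Prod>i=1..k. 1)"
    using assms(2) weights_nonneg[OF assms(1)]
    by (intro prod_mono_strict[of 1]) (auto intro: less_imp_le)
  then show False
    using weights_prod[OF assms(1)] by simp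
qed

lemma restrict_1_in_weights: "restrict (\<lambda>_. 1) {1..k} \<in> weights k"
  by (auto simp: weights_def)

text \<open>A weighted mean of \<open>h\<close> is at least minus the sum of the absolute values,
  and \<open>c\<close> over a denominator at least one subtracts at most \<open>c\<close>. A real
  \<open>INF\<close> lies below its terms only once such a bound is known.\<close>

lemma bdd_below_weighted_mean:
  fixes h :: "nat \<Rightarrow> real"
  assumes "k \<ge> 1" "c \<ge> 0"
  shows "bdd_below ((\<lambda>\<alpha>. ((\<Sum>i=1..k. \<alpha> i * h i) - c) / (\<Sum>i=1..k. \<alpha> i)) ` weights k)"
proof (rule bdd_belowI2)
  fix \<alpha> assume \<alpha>: "\<alpha> \<in> weights k"
  define A where "A = (\<Sum>i=1..k. \<alpha> i)"
  define b where "b = (\<Sum>i=1..k. \<bar>h i\<bar>)"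
  have A: "A \<ge> 1"
    unfolding A_def using weights_sum_ge_1[OF \<alpha> assms(1)] .
  have "(\<Sum>i=1..k. \<alpha> i * (- b)) \<le> (\<Sum>i=1..k. \<alpha> i * h i)"
  proof (intro sum_mono mult_left_mono)
    fix i assume i: "i \<in> {1..k}"
    have "\<bar>h i\<bar> \<le> b"
      unfolding b_def using i by (intro member_le_sum) auto
    then show "- b \<le> h i" by linarith
    show "0 \<le> \<alpha> i" using \<alpha> i by (rule weights_nonneg)
  qed
  then have "A * (- b) \<le> (\<Sum>i=1..k. \<alpha> i * h i)"
    by (simp add: A_def sum_distrib_right sum_negf)
  moreover have "c \<le> A * c"
    using mult_right_mono[OF A assms(2)] by simp
  ultimately have "(- b - c) * A \<le> (\<Sum>i=1..k. \<alpha> i * h i) - c"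
    by (simp add: algebra_simps)
  then show "- b - c \<le> ((\<Sum>i=1..k. \<alpha> i * h i) - c) / (\<Sum>i=1..k. \<alpha> i)"
    using A unfolding A_def[symmetric] by (simp add: pos_le_divide_eq)
qed

section \<open>Clearing the denominator in the infimum\<close>

lemma sum_mult_diff_const:
  fixes \<alpha> h :: "nat \<Rightarrow> real"
  shows "(\<Sum>i=1..k. \<alpha> i * (h i - a)) = (\<Sum>i=1..k. \<alpha> i * h i) - a * (\<Sum>i=1..k. \<alpha> i)"
  by (simp add: right_diff_distrib sum_subtractf sum_distrib_left mult.commute)

lemma le_INF_weightsD:
  fixes h :: "nat \<Rightarrow> real"
  assumes "k \<ge> 1" "c \<ge> 0" "\<alpha> \<in> weights k"
    and le: "a \<le> (INF \<alpha>\<in>weights k. ((\<Sum>i=1..k. \<alpha> i * h i) - c) / (\<Sum>i=1..k. \<alpha> i))"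
  shows "c \<le> (\<Sum>i=1..k. \<alpha> i * (h i - a))"
proof -
  have "a \<le> ((\<Sum>i=1..k. \<alpha> i * h i) - c) / (\<Sum>i=1..k. \<alpha> i)"
    using cINF_lower[OF bdd_below_weighted_mean[OF assms(1,2)] assms(3), of h] le by linarith
  then have "a * (\<Sum>i=1..k. \<alpha> i) \<le> (\<Sum>i=1..k. \<alpha> i * h i) - c"
    using weights_sum_ge_1[OF assms(3,1)] by (subst (asm) pos_le_divide_eq) auto
  then show ?thesis
    unfolding sum_mult_diff_const by simp
qed

text \<open>Attainment of the infimum is not established, so a near-minimiser is taken; its error
  \<open>\<epsilon>\<close> gets multiplied by the denominator.\<close>

lemma INF_weights_leD:
  fixes h :: "nat \<Rightarrow> real"
  assumes "k \<ge> 1" "\<epsilon> > 0"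
    and le: "(INF \<alpha>\<in>weights k. ((\<Sum>i=1..k. \<alpha> i * h i) - c) / (\<Sum>i=1..k. \<alpha> i)) \<le> a"
  obtains \<alpha> where "\<alpha> \<in> weights k"
    and "(\<Sum>i=1..k. \<alpha> i * (h i - a)) < c + \<epsilon> * (\<Sum>i=1..k. \<alpha> i)"
proof -
  have "(INF \<alpha>\<in>weights k. ((\<Sum>i=1..k. \<alpha> i * h i) - c) / (\<Sum>i=1..k. \<alpha> i)) < a + \<epsilon>"
    using le assms(2) by linarith
  then obtain \<alpha> where \<alpha>: "\<alpha> \<in> weights k"
    and *: "((\<Sum>i=1..k. \<alpha> i * h i) - c) / (\<Sum>i=1..k. \<alpha> i) < a + \<epsilon>"
    using restrict_1_in_weights by (blast dest!: cInf_lessD[rotated])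
  have "(\<Sum>i=1..k. \<alpha> i * h i) - c < (a + \<epsilon>) * (\<Sum>i=1..k. \<alpha> i)"
    using * weights_sum_ge_1[OF \<alpha> assms(1)] by (subst (asm) pos_divide_less_eq) auto
  then show thesis
    using \<alpha> by (intro that[of \<alpha>]) (auto simp only: sum_mult_diff_const distrib_right)
qed

section \<open>Positivity and a uniform gap for weighted sums\<close>

lemma pos_if_weighted_sums_ge:
  fixes h :: "nat \<Rightarrow> real"
  assumes ge: "\<And>\<alpha>. \<alpha> \<in> weights k \<Longrightarrow> c \<le> (\<Sum>i=1..k. \<alpha> i * h i)"
    and "c > 0" and j: "j \<in> {1..k}"
  shows "h j > 0"
proof (rule ccontr)
  assume "\<not> h j > 0"
  define b where "b = (\<Sum>i\<in>{1..k} - {j}. \<bar>h i\<bar>)"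
  \<comment> \<open>Chosen so that \<open>b / t < c\<close>; the added one keeps \<open>t\<close>
    positive when \<open>b = 0\<close>.\<close>
  define t where "t = (b + 1) / c"
  have b: "b \<ge> 0" unfolding b_def by (simp add: sum_nonneg)
  then have t: "t > 0" using \<open>c > 0\<close> by (simp add: t_def)
  \<comment> \<open>The power at \<open>j\<close> balances the \<open>k - 1\<close> factors
    \<open>1 / t\<close>, so the product is one.\<close>
  define \<alpha> where "\<alpha> = restrict (\<lambda>i. if i = j then t ^ (k - 1) else 1 / t) {1..k}"
  have "(\<Prod>i=1..k. \<alpha> i) = \<alpha> j * (\<Prod>i\<in>{1..k} - {j}. \<alpha> i)"
    using j by (simp add: prod.remove)
  also have "(\<Prod>i\<in>{1..k} - {j}. \<alpha> i) = (\<Prod>i\<in>{1..k} - {j}. 1 / t)"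
    by (intro prod.cong) (auto simp: \<alpha>_def)
  also have "\<alpha> j * \<dots> = 1"
    using j t by (simp add: \<alpha>_def power_one_over)
  finally have "\<alpha> \<in> weights k"
    using t by (auto simp: weights_def \<alpha>_def)
  then have "c \<le> (\<Sum>i=1..k. \<alpha> i * h i)"
    by (rule ge)
  also have "\<dots> = \<alpha> j * h j + (\<Sum>i\<in>{1..k} - {j}. \<alpha> i * h i)"
    using j by (simp add: sum.remove)
  also have "\<dots> \<le> 0 + (\<Sum>i\<in>{1..k} - {j}. 1 / t * \<bar>h i\<bar>)"
  proof (intro add_mono sum_mono)
    show "\<alpha> j * h j \<le> 0"
      using \<open>\<not> h j > 0\<close> t j by (simp add: \<alpha>_def mult_nonneg_nonpos)
    fix i assume "i \<in> {1..k} - {j}"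
    then show "\<alpha> i * h i \<le> 1 / t * \<bar>h i\<bar>"
      using t by (auto simp: \<alpha>_def divide_right_mono)
  qed
  also have "\<dots> = b / t"
    by (simp add: b_def sum_divide_distrib)
  also have "\<dots> < c"
    using b \<open>c > 0\<close> by (simp add: t_def field_simps)
  finally show False by simp
qed

text \<open>The product is one and each of the other \<open>k - 1\<close> weights is at most the
  sum, hence at most \<open>C\<close>.\<close>

lemma weight_lower_bound:
  assumes "\<alpha> \<in> weights k" "j \<in> {1..k}" "(\<Sum>i=1..k. \<alpha> i) \<le> C"
  shows "1 \<le> \<alpha> j * C ^ (k - 1)"
proof -
  have "1 = \<alpha> j * (\<Prod>i\<in>{1..k} - {j}. \<alpha> i)"
    using assms(2) weights_prod[OF assms(1)] by (simp add: prod.remove)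
  also have "\<dots> \<le> \<alpha> j * (\<Prod>i\<in>{1..k} - {j}. C)"
  proof (intro mult_left_mono prod_mono conjI)
    show "0 \<le> \<alpha> j" using assms(1,2) by (rule weights_nonneg)
    fix i assume "i \<in> {1..k} - {j}"
    then have i: "i \<in> {1..k}" by simp
    show "0 \<le> \<alpha> i" using assms(1) i by (rule weights_nonneg)
    show "\<alpha> i \<le> C" using weights_le_sum[OF assms(1) i] assms(3) by linarith
  qed
  also have "\<dots> = \<alpha> j * C ^ (k - 1)"
    using assms(2) by simp
  finally show ?thesis .
qed

text \<open>The gain at \<open>j\<close> is \<open>\<alpha> j\<close> times a fixed amount, which
  degenerates as \<open>\<alpha> j\<close> tends to zero. That forces the total weight to be large,
  and then positivity of all \<open>h i\<close> gives the gap instead. The error has the form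
  produced by \<open>INF_weights_leD\<close>.\<close>

lemma weighted_sum_gap:
  fixes h h' :: "nat \<Rightarrow> real"
  assumes ge: "\<And>\<alpha>. \<alpha> \<in> weights k \<Longrightarrow> c \<le> (\<Sum>i=1..k. \<alpha> i * h i)"
    and c: "c > 0"
    and le: "\<And>i. i \<in> {1..k} \<Longrightarrow> h i \<le> h' i"
    and j: "j \<in> {1..k}" and less: "h j < h' j"
  obtains \<epsilon> where "\<epsilon> > 0"
    and "\<And>\<alpha>. \<alpha> \<in> weights k \<Longrightarrow> c + \<epsilon> * (\<Sum>i=1..k. \<alpha> i) \<le> (\<Sum>i=1..k. \<alpha> i * h' i)"
proof -
  define m where "m = Min (h ` {1..k})"
  have "m \<in> h ` {1..k}"
    unfolding m_def using j by (intro Min_in) auto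
  then have m: "m > 0"
    using pos_if_weighted_sums_ge[OF ge c] by auto
  have m_le: "m \<le> h i" if "i \<in> {1..k}" for i
    unfolding m_def using that by (intro Min_le) auto
  define \<delta> where "\<delta> = h' j - h j"
  have \<delta>: "\<delta> > 0" using less by (simp add: \<delta>_def)
  \<comment> \<open>Once the total weight reaches \<open>C\<close>, half of \<open>m\<close> times
    it covers \<open>c\<close>; the other half is left for \<open>\<epsilon>\<close>.\<close>
  define C where "C = 2 * c / m"
  have C: "C > 0" using c m by (simp add: C_def)
  \<comment> \<open>The second bound serves total weight below \<open>C\<close>: there the gain
    \<open>\<alpha> j * \<delta>\<close> is at least \<open>\<delta> * C / C ^ k\<close>, which
    dominates \<open>\<epsilon> * C\<close>.\<close>
  define \<epsilon> where "\<epsilon> = min (m / 2) (\<delta> / C ^ k)"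
  have \<epsilon>_le: "\<epsilon> \<le> m / 2" "\<epsilon> \<le> \<delta> / C ^ k"
    by (simp_all only: \<epsilon>_def min.cobounded1 min.cobounded2)
  have \<epsilon>: "\<epsilon> > 0" using m \<delta> C by (simp add: \<epsilon>_def)
  have "c + \<epsilon> * (\<Sum>i=1..k. \<alpha> i) \<le> (\<Sum>i=1..k. \<alpha> i * h' i)" if \<alpha>: "\<alpha> \<in> weights k" for \<alpha>
  proof -
    define A where "A = (\<Sum>i=1..k. \<alpha> i)"
    have \<alpha>_nonneg: "0 \<le> \<alpha> i" if "i \<in> {1..k}" for i
      by (rule weights_nonneg[OF \<alpha> that])
    then have A: "A \<ge> 0" unfolding A_def by (intro sum_nonneg) auto
    have "c + \<epsilon> * A \<le> (\<Sum>i=1..k. \<alpha> i * h' i)"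
    proof (cases "A \<ge> C")
      case True
      have "c = m / 2 * C" using m by (simp add: C_def)
      also have "\<dots> \<le> m / 2 * A" using True m by (intro mult_left_mono) auto
      finally have "c \<le> m / 2 * A" .
      moreover have "\<epsilon> * A \<le> m / 2 * A"
        using \<epsilon>_le(1) A by (rule mult_right_mono)
      ultimately have "c + \<epsilon> * A \<le> A * m"
        by (simp add: mult.commute)
      also have "\<dots> = (\<Sum>i=1..k. \<alpha> i * m)"
        by (simp add: A_def sum_distrib_right)
      also have "\<dots> \<le> (\<Sum>i=1..k. \<alpha> i * h' i)"
        using \<alpha>_nonneg m_le le by (intro sum_mono mult_left_mono) (auto intro: order_trans)
      finally show ?thesis .
    next
      case False
      then have "1 \<le> \<alpha> j * C ^ (k - 1)"
        using weight_lower_bound[OF \<alpha> j, of C] by (simp add: A_def)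
      then have "C \<le> \<alpha> j * C ^ (k - 1) * C"
        using C by simp
      also have "\<dots> = \<alpha> j * C ^ k"
        using j by (cases k) auto
      finally have "C / C ^ k \<le> \<alpha> j"
        using C by (simp add: pos_divide_le_eq)
      then have "\<delta> * (C / C ^ k) \<le> \<delta> * \<alpha> j"
        using \<delta> by (intro mult_left_mono) auto
      moreover have "\<epsilon> * A \<le> \<delta> / C ^ k * C"
        using \<epsilon>_le(2) False A C \<delta> by (intro mult_mono) auto
      ultimately have "\<epsilon> * A \<le> \<alpha> j * \<delta>"
        by (simp add: mult.commute)
      moreover have "c \<le> \<alpha> j * h j + (\<Sum>i\<in>{1..k} - {j}. \<alpha> i * h i)"
        using ge[OF \<alpha>] j by (simp add: sum.remove)
      moreover have "(\<Sum>i\<in>{1..k} - {j}. \<alpha> i * h i) \<le> (\<Sum>i\<in>{1..k} - {j}. \<alpha> i * h' i)"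
        using \<alpha>_nonneg le by (intro sum_mono mult_left_mono) auto
      moreover have "(\<Sum>i=1..k. \<alpha> i * h' i) = \<alpha> j * h' j + (\<Sum>i\<in>{1..k} - {j}. \<alpha> i * h' i)"
        using j by (simp add: sum.remove)
      ultimately show ?thesis
        by (simp add: \<delta>_def algebra_simps)
    qed
    then show ?thesis by (simp add: A_def)
  qed
  with \<epsilon> show thesis by (rule that)
qed

section \<open>The operators H as minima of top-pair means\<close>

definition top_mean :: "('a \<Rightarrow> real) \<Rightarrow> 'a set \<Rightarrow> real" where
  "top_mean u S = Max {(u y + u z) / 2 | y z. y \<in> S \<and> z \<in> S \<and> y \<noteq> z}"

lemma finite_pair_means:
  fixes u :: "'a \<Rightarrow> real"
  assumes "finite S"
  shows "finite {(u y + u z) / 2 | y z. y \<in> S \<and> z \<in> S \<and> y \<noteq> z}"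
proof (rule finite_subset)
  show "{(u y + u z) / 2 | y z. y \<in> S \<and> z \<in> S \<and> y \<noteq> z} \<subseteq> (\<lambda>(y, z). (u y + u z) / 2) ` (S \<times> S)"
    by force
qed (use assms in simp)

lemma top_mean_ge:
  assumes "finite S" "y \<in> S" "z \<in> S" "y \<noteq> z"
  shows "(u y + u z) / 2 \<le> top_mean u S"
  unfolding top_mean_def using assms by (intro Max_ge finite_pair_means) auto

lemma top_mean_attained:
  assumes "card S \<ge> 2"
  obtains y z where "y \<in> S" "z \<in> S" "y \<noteq> z" "top_mean u S = (u y + u z) / 2"
proof -
  have fin: "finite S" using assms by (auto intro: card_ge_0_finite)
  obtain T where "T \<subseteq> S" "card T = 2"
    using obtain_subset_with_card_n[OF assms] by metis
  then obtain y z where "y \<in> S" "z \<in> S" "y \<noteq> z"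
    by (auto simp: card_2_iff)
  then have "{(u y + u z) / 2 | y z. y \<in> S \<and> z \<in> S \<and> y \<noteq> z} \<noteq> {}"
    by blast
  from Max_in[OF finite_pair_means[OF fin] this] show thesis
    unfolding top_mean_def[symmetric] using that by blast
qed

text \<open>The pair that is optimal for \<open>u\<close> competes in the maximum for
  \<open>v\<close>.\<close>

lemma top_mean_le_add:
  assumes "card S \<ge> 2" "\<And>y. y \<in> S \<Longrightarrow> u y \<le> v y + M"
  shows "top_mean u S \<le> top_mean v S + M"
proof -
  have "finite S" using assms(1) by (auto intro: card_ge_0_finite)
  from assms(1) obtain y z where yz: "y \<in> S" "z \<in> S" "y \<noteq> z" "top_mean u S = (u y + u z) / 2"
    by (rule top_mean_attained)
  with assms(2)[OF yz(1)] assms(2)[OF yz(2)] top_mean_ge[OF \<open>finite S\<close> yz(1-3), of v]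
  show ?thesis by (simp add: field_simps)
qed

lemma H_eq_Min_top_mean:
  "H E i u x = Min (top_mean u ` {S. S \<subseteq> neighbours E x \<and> card S = 2 * i})"
  by (simp add: H_def top_mean_def)

text \<open>A subset that is optimal for \<open>v\<close> competes in the minimum for
  \<open>u\<close>.\<close>

lemma H_le_add:
  assumes "finite (neighbours E x)" "1 \<le> i" "2 * i \<le> card (neighbours E x)"
    and "\<And>y. y \<in> neighbours E x \<Longrightarrow> u y \<le> v y + M"
  shows "H E i u x \<le> H E i v x + M"
proof -
  let ?\<S> = "{S. S \<subseteq> neighbours E x \<and> card S = 2 * i}"
  have fin: "finite ?\<S>"
    using assms(1) by simp
  obtain T where "T \<subseteq> neighbours E x" "card T = 2 * i"
    using obtain_subset_with_card_n[OF assms(3)] by metis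
  then have "?\<S> \<noteq> {}" by auto
  with fin have "Min (top_mean v ` ?\<S>) \<in> top_mean v ` ?\<S>"
    by (intro Min_in) auto
  then obtain S where S: "S \<in> ?\<S>" "H E i v x = top_mean v S"
    by (auto simp: H_eq_Min_top_mean)
  have "H E i u x \<le> top_mean u S"
    unfolding H_eq_Min_top_mean using fin S(1) by (intro Min_le) auto
  also have "\<dots> \<le> top_mean v S + M"
    using S(1) assms(2,4) by (intro top_mean_le_add) auto
  finally show ?thesis using S(2) by simp
qed

text \<open>Only one subset has full size, so the minimum disappears. Strictness in the comparison
  is obtained at this index.\<close>

lemma H_full:
  assumes "finite (neighbours E x)" "card (neighbours E x) = 2 * i"
  shows "H E i u x = top_mean u (neighbours E x)"
proof -
  have "{S. S \<subseteq> neighbours E x \<and> card S = 2 * i} = {neighbours E x}"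
    using assms card_subset_eq[OF assms(1)] by auto
  then show ?thesis by (simp add: H_eq_Min_top_mean)
qed

section \<open>The comparison principle\<close>

lemma neighbours_subset:
  assumes "finite_simple_graph X E"
  shows "neighbours E x \<subseteq> X"
  using assms by (auto simp: finite_simple_graph_def neighbours_def)

theorem theorem3p5:
  fixes X B :: "'a set" and E :: "'a set set" and n :: nat
    and f g u v :: "'a \<Rightarrow> real"
  assumes graph: "finite_simple_graph X E"
    and boundary: "B \<subseteq> X"
    and n: "even n" "n \<ge> 2"
    and degree: "\<forall>x \<in> X - B. card (neighbours E x) = n"
    and f_pos: "\<forall>x \<in> X - B. f x > 0"
    and u_sub: "\<forall>x \<in> X - B. u x \<le> F E n f u x"
    and u_bdry: "\<forall>x \<in> B. u x \<le> g x"
    and v_super: "\<forall>x \<in> X - B. v x \<ge> F E n f v x"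
    and v_bdry: "\<forall>x \<in> B. v x \<ge> g x"
  shows "\<forall>x \<in> X. u x \<le> v x"
proof (rule ccontr)
  assume "\<not> ?thesis"
  then obtain x0 where x0: "x0 \<in> X" "u x0 > v x0" by force
  have "finite X" using graph by (simp add: finite_simple_graph_def)
  define M where "M = Max ((\<lambda>x. u x - v x) ` X)"
  have M_ge: "u y \<le> v y + M" if "y \<in> X" for y
  proof -
    have "u y - v y \<le> M"
      unfolding M_def using \<open>finite X\<close> that by (intro Max_ge) auto
    then show ?thesis by simp
  qed
  have "M > 0" using M_ge[OF x0(1)] x0(2) by simp
  define A where "A = {x \<in> X. u x - v x = M}"
  have "M \<in> (\<lambda>x. u x - v x) ` X"
    unfolding M_def using \<open>finite X\<close> x0(1) by (intro Max_in) auto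
  then have A: "A \<noteq> {}" "finite A" using \<open>finite X\<close> by (auto simp: A_def)
  then have "Max (u ` A) \<in> u ` A" by (intro Max_in) auto
  then obtain x where x: "x \<in> A" "u x = Max (u ` A)" by auto
  have max: "u y \<le> u x" if "y \<in> A" for y
    using that A x(2) by simp
  have xX: "x \<in> X" and ux: "u x = v x + M" using x(1) by (auto simp: A_def)
  \<comment> \<open>On \<open>B\<close> the values of \<open>g\<close> separate \<open>u\<close>
    from \<open>v\<close>, which excludes a positive difference.\<close>
  have "x \<notin> B"
    using ux \<open>M > 0\<close> u_bdry v_bdry by fastforce
  with xX have xi: "x \<in> X - B" by simp

  define k where "k = n div 2"
  \<comment> \<open>This term depends on \<open>f\<close> and \<open>x\<close> only, so it is common
    to the inequalities for \<open>u\<close> and \<open>v\<close>.\<close>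
  define c where "c = real n / 2 * f x powr (2 / real n)"
  have k: "n = 2 * k" "k \<ge> 1" using n by (auto simp: k_def)
  have "f x > 0" using f_pos xi by blast
  then have c: "c > 0" using n by (simp add: c_def)
  let ?N = "neighbours E x"
  have N: "?N \<subseteq> X" using graph by (rule neighbours_subset)
  have cardN: "card ?N = 2 * k" using degree xi k by simp
  have finN: "finite ?N" using N \<open>finite X\<close> by (rule finite_subset)

  have ge: "c \<le> (\<Sum>i=1..k. \<alpha> i * (H E i u x - u x))" if "\<alpha> \<in> weights k" for \<alpha>
  proof (rule le_INF_weightsD[OF k(2) less_imp_le[OF c] that])
    have "u x \<le> F E n f u x" using u_sub xi by blast
    then show "u x \<le> (INF \<alpha>\<in>weights k.
        ((\<Sum>i=1..k. \<alpha> i * H E i u x) - c) / (\<Sum>i=1..k. \<alpha> i))"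
      unfolding F_def k_def[symmetric] c_def[symmetric] .
  qed
  have kk: "k \<in> {1..k}" using k by simp
  have "H E k u x - u x > 0"
    using pos_if_weighted_sums_ge[of k c "\<lambda>i. H E i u x - u x", OF ge c kk] .
  moreover have "card ?N \<ge> 2" using cardN k by simp
  then obtain y z where yz: "y \<in> ?N" "z \<in> ?N" "y \<noteq> z" "H E k u x = (u y + u z) / 2"
    using top_mean_attained[of ?N u] H_full[OF finN cardN, of u] by metis
  ultimately have "u y > u x \<or> u z > u x" by auto
  then have "y \<notin> A \<or> z \<notin> A" using max by fastforce
  then have "u y < v y + M \<or> u z < v z + M"
    using yz N M_ge by (fastforce simp: A_def)
  then have "u y + u z < v y + v z + 2 * M"
    using M_ge[of y] M_ge[of z] yz N by auto
  \<comment> \<open>The pair \<open>y\<close>, \<open>z\<close> need not be optimal for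
    \<open>v\<close>, but its mean bounds the top mean of \<open>v\<close> from below. The shift
    \<open>M\<close> cancels against \<open>u x = v x + M\<close>.\<close>
  then have less: "H E k u x - u x < H E k v x - v x"
    using yz(4) top_mean_ge[OF finN yz(1-3), of v] H_full[OF finN cardN, of v] ux by simp
  have le: "H E i u x - u x \<le> H E i v x - v x" if "i \<in> {1..k}" for i
    using H_le_add[OF finN, of i u v M] that cardN M_ge N ux by fastforce

  obtain \<epsilon> where \<epsilon>: "\<epsilon> > 0"
    and gap: "\<And>\<alpha>. \<alpha> \<in> weights k \<Longrightarrow>
      c + \<epsilon> * (\<Sum>i=1..k. \<alpha> i) \<le> (\<Sum>i=1..k. \<alpha> i * (H E i v x - v x))"
    using weighted_sum_gap[of k c "\<lambda>i. H E i u x - u x" "\<lambda>i. H E i v x - v x", OF ge c le kk less]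
    by blast
  \<comment> \<open>A near-minimiser for \<open>v\<close> with precision \<open>\<epsilon>\<close>
    violates the gap.\<close>
  have "F E n f v x \<le> v x" using v_super xi by simp
  then obtain \<alpha> where "\<alpha> \<in> weights k"
    and "(\<Sum>i=1..k. \<alpha> i * (H E i v x - v x)) < c + \<epsilon> * (\<Sum>i=1..k. \<alpha> i)"
    unfolding F_def k_def[symmetric] c_def[symmetric]
    by (rule INF_weights_leD[OF k(2) \<epsilon>])
  with gap[of \<alpha>] show False by simp
qed

end
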